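(* Let $m$ be a positive even integer and let $k\ge 0$ be an integer. Any set of $n$ points of $\mathbb{R}^2$ in general position with respect to degree $m$ homogeneous polynomials has exactly $$2\binom{k+m/2}{m/2}\binom{n-k-m/2-1}{m/2}$$ $\mathcal{H}_m^2$-$k$-facets.
   Context: The degree $m$ homogeneous Veronese map of the plane is $HV_m^2:\mathbb{R}^2\to\mathbb{R}^{m+1}$, mapping $(x,y)$ to the vector (in some fixed order) of all monomials of degree $m$ in $x,y$. A set of at least $d+1$ points in $\mathbb{R}^d$ is in general linear position if no $d+1$ (and thus no fewer) of its points are affinely dependent. A set $S\subset\mathbb{R}^2$ is in general position with respect to degree $m$ homogeneous polynomials if no two points of $S$ lie on a common line through the origin and $HV_m^2(S)$ is in general linear position in $\mathbb{R}^{m+1}$. For a finite set $P\subset\mathbb{R}^p$ in general linear position, a $k$-facet of $P$ is a pair consisting of a subset $\Delta\subset P$ of $p$ points and an orientation of the hyperplane $\operatorname{aff}\Delta$ such that the open halfspace on the positive side of $\operatorname{aff}\Delta$ contains exactly $k$ points of $P$ (the two orientations of the same hyperplane count as different). For a finite $S\subset\mathbb{R}^2$ with $HV_m^2(S)$ in general linear position, an $\mathcal{H}_m^2$-$k$-facet of $S$ is a subset $Q\subset S$ of $m+1$ points together with an orientation of $\operatorname{aff}HV_m^2(Q)$ such that $HV_m^2(Q)$ with this orientation is a $k$-facet of $HV_m^2(S)$. Convention: $\binom{a}{b}=0$ for integers $a<b$, $b\ge 0$ (including $a<0$); the formula is of interest for $0\le k\le n-m-1$. *)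

theory Defs
  imports "HOL-Analysis.Analysis"
begin

text \<open>
  The vector space \<^typ>\<open>real ^ 'd\<close> with \<open>CARD('d) = m + 1\<close> plays the role of the (m+1)-dimensional
  target of the Veronese map. The fixed order of the monomials is given by a bijection \<open>e\<close> from
  the index type onto \<open>{..m}\<close>, where coordinate \<open>i\<close> carries the monomial \<open>x ^ e i * y ^ (m - e i)\<close>.
\<close>

definition monomial_order :: "nat \<Rightarrow> ('d::finite \<Rightarrow> nat) \<Rightarrow> bool" where
  "monomial_order m e \<longleftrightarrow> bij_betw e UNIV {..m}"

definition HV :: "nat \<Rightarrow> ('d::finite \<Rightarrow> nat) \<Rightarrow> real \<times> real \<Rightarrow> real ^ 'd" where
  "HV m e = (\<lambda>(x, y). \<chi> i. x ^ e i * y ^ (m - e i))"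

definition general_linear_position :: "'a::euclidean_space set \<Rightarrow> bool" where
  "general_linear_position P \<longleftrightarrow>
     (infinite P \<or> DIM('a) + 1 \<le> card P) \<and>
     (\<forall>T\<subseteq>P. card T = DIM('a) + 1 \<longrightarrow> \<not> affine_dependent T)"

definition line_through_origin :: "'a::euclidean_space set \<Rightarrow> bool" where
  "line_through_origin L \<longleftrightarrow> subspace L \<and> dim L = 1"

definition homogeneous_general_position ::
    "nat \<Rightarrow> ('d::finite \<Rightarrow> nat) \<Rightarrow> (real \<times> real) set \<Rightarrow> bool" where
  "homogeneous_general_position m e S \<longleftrightarrow>
     (\<forall>p\<in>S. \<forall>q\<in>S. p \<noteq> q \<longrightarrow> \<not> (\<exists>L. line_through_origin L \<and> p \<in> L \<and> q \<in> L)) \<and>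
     general_linear_position (HV m e ` S)"

text \<open>
  An orientation of a hyperplane \<open>h\<close> is represented by its open halfspace \<open>H\<close> on the positive side,
  so every hyperplane has exactly two orientations. If \<open>h\<close> is not a hyperplane, it has none.
\<close>

definition orientation_of :: "'a::euclidean_space set \<Rightarrow> 'a set \<Rightarrow> bool" where
  "orientation_of h H \<longleftrightarrow>
     (\<exists>a b. a \<noteq> 0 \<and> h = {x. a \<bullet> x = b} \<and> H = {x. a \<bullet> x > b})"

definition k_facets :: "nat \<Rightarrow> 'a::euclidean_space set \<Rightarrow> ('a set \<times> 'a set) set" where
  "k_facets k P =
     {(\<Delta>, H). \<Delta> \<subseteq> P \<and> card \<Delta> = DIM('a) \<and>
              orientation_of (affine hull \<Delta>) H \<and> card (P \<inter> H) = k}"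

definition homogeneous_k_facets ::
    "nat \<Rightarrow> ('d::finite \<Rightarrow> nat) \<Rightarrow> nat \<Rightarrow> (real \<times> real) set \<Rightarrow>
     ((real \<times> real) set \<times> (real ^ 'd) set) set" where
  "homogeneous_k_facets m e k S =
     {(Q, H). Q \<subseteq> S \<and> card Q = m + 1 \<and> (HV m e ` Q, H) \<in> k_facets k (HV m e ` S)}"

end

(*
With an affine coordinate tau on the lines through the origin, the Veronese image of a point p is
w(p) * (monomials in tau(p)) with w(p) > 0, up to a linear change of coordinates. No m + 1 of these
vectors lie on a hyperplane through the origin, so each hyperplane spanned by m + 1 of them is
{a . x = 1}, and a corresponds to the polynomial F of degree at most m that interpolates c = 1/w at
the chosen points; the sides of the hyperplane are given by F > c and F < c. Hence, with t = m/2,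
it suffices to show that for any generic c on n reals exactly
(k+t choose t) * (n-k-t-1 choose t) of the (2t+1)-subsets Q have exactly k points with F_Q > c,
and to apply this to c and to -c.

For k = 0, send Q to its t vertices of odd rank. Among all Q with given odd vertices there is exactly
one with F_Q <= c, the one whose F_Q has the least leading coefficient; and the possible sets of odd
vertices among r points are the t-subsets without neighbours in the inner r - 2 points, of which
there are (r-t-1 choose t). Counting the lower facets of all r-subsets, for every r, gives a
triangular linear system that determines the numbers for all k.
*)
theory Submission
  imports Defs "HOL-Computational_Algebra.Polynomial"
begin

section \<open>Lagrange interpolation and divided differences\<close>

definition nodal :: "real set \<Rightarrow> real poly" where
  "nodal Q = (\<Prod>x\<in>Q. [:-x, 1:])"

lemma poly_nodal: "poly (nodal Q) y = (\<Prod>x\<in>Q. y - x)"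
  by (simp add: nodal_def poly_prod)

lemma degree_nodal: "degree (nodal Q) = card Q"
  unfolding nodal_def by (subst degree_prod_eq_sum_degree) auto

lemma coeff_nodal_card: "coeff (nodal Q) (card Q) = 1"
proof -
  have "lead_coeff (nodal Q) = 1"
    unfolding nodal_def by (simp add: lead_coeff_prod)
  then show ?thesis by (simp add: degree_nodal)
qed

definition interp :: "real set \<Rightarrow> (real \<Rightarrow> real) \<Rightarrow> real poly" where
  "interp Q c = (\<Sum>q\<in>Q. smult (c q / (\<Prod>x\<in>Q - {q}. q - x)) (nodal (Q - {q})))"

text \<open>The divided difference of \<open>c\<close> over the nodes \<open>Q\<close> in its
  symmetric form, in which the sign of each node's contribution is visible.\<close>

definition divdiff :: "real set \<Rightarrow> (real \<Rightarrow> real) \<Rightarrow> real" where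
  "divdiff Q c = (\<Sum>q\<in>Q. c q / (\<Prod>x\<in>Q - {q}. q - x))"

lemma degree_interp:
  assumes "finite Q" "card Q = Suc d"
  shows "degree (interp Q c) \<le> d"
  unfolding interp_def using assms
  by (intro degree_sum_le) (auto intro!: order.trans[OF degree_smult_le] simp: degree_nodal)

lemma poly_interp:
  assumes "finite Q" "q \<in> Q"
  shows "poly (interp Q c) q = c q"
proof -
  have "poly (interp Q c) q
      = (\<Sum>p\<in>Q. c p / (\<Prod>x\<in>Q - {p}. p - x) * (\<Prod>x\<in>Q - {p}. q - x))"
    by (simp add: interp_def poly_sum poly_nodal)
  also have "\<dots> = (\<Sum>p\<in>Q. if p = q then c q else 0)"
  proof (rule sum.cong[OF refl])
    fix p assume "p \<in> Q"
    show "c p / (\<Prod>x\<in>Q - {p}. p - x) * (\<Prod>x\<in>Q - {p}. q - x) = (if p = q then c q else 0)"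
    proof (cases "p = q")
      case True
      have "(\<Prod>x\<in>Q - {q}. q - x) \<noteq> 0" using assms by auto
      then show ?thesis using True by simp
    next
      case False
      then have "(\<Prod>x\<in>Q - {p}. q - x) = 0" using assms by (auto intro: prod_zero)
      then show ?thesis using False by simp
    qed
  qed
  also have "\<dots> = c q" using assms by simp
  finally show ?thesis .
qed

lemma poly_eq_if_agree:
  fixes f g :: "real poly"
  assumes "finite Q" "card Q = Suc d" "degree f \<le> d" "degree g \<le> d"
    and "\<And>q. q \<in> Q \<Longrightarrow> poly f q = poly g q"
  shows "f = g"
proof (rule ccontr)
  assume "f \<noteq> g"
  then have nz: "f - g \<noteq> 0" by simp
  have "card Q \<le> card {x. poly (f - g) x = 0}"
    using assms(5) by (intro card_mono poly_roots_finite[OF nz]) auto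
  also have "\<dots> \<le> degree (f - g)" by (rule card_poly_roots_bound[OF nz])
  also have "\<dots> \<le> d" using assms(3,4) by (meson degree_diff_le)
  finally show False using assms(2) by simp
qed

lemma interp_poly:
  assumes "finite Q" "card Q = Suc d" "degree f \<le> d"
  shows "interp Q (poly f) = f"
  by (rule poly_eq_if_agree[OF assms(1,2) degree_interp[OF assms(1,2)] assms(3)])
    (simp add: poly_interp assms(1))

lemma coeff_interp:
  assumes "finite Q" "card Q = Suc d"
  shows "coeff (interp Q c) d = divdiff Q c"
proof -
  have "coeff (nodal (Q - {q})) d = 1" if "q \<in> Q" for q
    using coeff_nodal_card[of "Q - {q}"] assms that by simp
  then show ?thesis by (simp add: interp_def divdiff_def coeff_sum)
qed

text \<open>A polynomial of degree at most \<open>d\<close> is its own interpolant at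
  \<open>d + 1\<close> nodes. Applied to the difference of two interpolants, this compares their
  coefficients of degree \<open>d\<close> through values at the nodes.\<close>

lemma coeff_eq_divdiff:
  assumes "finite Q" "card Q = Suc d" "degree f \<le> d"
  shows "coeff f d = divdiff Q (poly f)"
  using coeff_interp[OF assms(1,2), of "poly f"] interp_poly[OF assms] by simp

lemma interp_uminus: "interp Q (\<lambda>x. - c x) = - interp Q c"
  by (simp add: interp_def sum_negf)

subsection \<open>Lower facets and their odd vertices\<close>

definition rank_in :: "'a::linorder set \<Rightarrow> 'a \<Rightarrow> nat" where
  "rank_in Q q = card {x\<in>Q. x < q}"

text \<open>Ranks start at 0, so neither end of a set of odd size is an odd vertex.\<close>
definition odds :: "'a::linorder set \<Rightarrow> 'a set" where
  "odds Q = {q\<in>Q. odd (rank_in Q q)}"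

lemma odds_subset: "odds Q \<subseteq> Q"
  by (auto simp: odds_def)

lemma card_odds: "finite Q \<Longrightarrow> card (odds Q) = card Q div 2"
proof (induction Q rule: finite_linorder_max_induct)
  case empty
  then show ?case by (simp add: odds_def)
next
  case (insert b A)
  have b: "b \<notin> A" using insert by auto
  have rb: "rank_in (insert b A) b = card A"
    unfolding rank_in_def using insert by (intro arg_cong[where f = card]) auto
  have ra: "rank_in (insert b A) a = rank_in A a" if "a \<in> A" for a
    unfolding rank_in_def using insert that by (intro arg_cong[where f = card]) force
  have "odds (insert b A) = odds A \<union> (if odd (card A) then {b} else {})"
    using b by (auto simp: odds_def rb ra)
  moreover have "b \<notin> odds A" "finite (odds A)"
    using b odds_subset[of A] insert finite_subset by auto
  ultimately show ?case using insert b by (auto simp: card_insert_if)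
qed

text \<open>Each node above \<open>q\<close> contributes a negative factor. As \<open>card Q\<close>
  is odd, the nodes other than \<open>q\<close> are even in number, so the number above
  \<open>q\<close> has the parity of the number below, which is the rank.\<close>

lemma sgn_prod_rank:
  fixes Q :: "real set"
  assumes "finite Q" "odd (card Q)" "q \<in> Q"
  shows "(\<Prod>x\<in>Q - {q}. q - x) > 0 \<longleftrightarrow> even (rank_in Q q)"
    and "(\<Prod>x\<in>Q - {q}. q - x) < 0 \<longleftrightarrow> odd (rank_in Q q)"
proof -
  define L where "L = {x\<in>Q. x < q}"
  define U where "U = {x\<in>Q. x > q}"
  have fin: "finite L" "finite U" and disj: "L \<inter> U = {}" and un: "Q - {q} = L \<union> U"
    using assms by (auto simp: L_def U_def)
  have "card L + card U = card (Q - {q})"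
    using card_Un_disjoint[OF fin disj] un by simp
  then have par: "even (card U) \<longleftrightarrow> even (rank_in Q q)"
  proof -
    have "even (card L + card U)"
      using \<open>card L + card U = card (Q - {q})\<close> assms by simp
    then show ?thesis by (simp add: rank_in_def flip: L_def)
  qed
  have "(\<Prod>x\<in>Q - {q}. q - x) = (\<Prod>x\<in>L. q - x) * (\<Prod>x\<in>U. q - x)"
    using prod.union_disjoint[OF fin disj] un by simp
  also have "(\<Prod>x\<in>U. q - x) = (\<Prod>x\<in>U. (-1) * (x - q))" by simp
  also have "\<dots> = (-1) ^ card U * (\<Prod>x\<in>U. x - q)"
    by (subst prod.distrib) simp
  finally have eq: "(\<Prod>x\<in>Q - {q}. q - x) = (-1) ^ card U * ((\<Prod>x\<in>L. q - x) * (\<Prod>x\<in>U. x - q))"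
    by simp
  have pos: "(\<Prod>x\<in>L. q - x) * (\<Prod>x\<in>U. x - q) > 0"
    by (intro mult_pos_pos prod_pos) (auto simp: L_def U_def)
  show "(\<Prod>x\<in>Q - {q}. q - x) > 0 \<longleftrightarrow> even (rank_in Q q)"
    and "(\<Prod>x\<in>Q - {q}. q - x) < 0 \<longleftrightarrow> odd (rank_in Q q)"
    unfolding eq par[symmetric] using pos by (cases "even (card U)"; simp)+
qed

text \<open>A neighbour of \<open>p\<close> in \<open>Q\<close> with even rank is traded for
  \<open>p\<close>. No other point of \<open>Q\<close> lies between the two, so \<open>p\<close>
  inherits its rank and all other ranks stay.\<close>

lemma exchange:
  fixes Q :: "'a::linorder set"
  assumes "finite Q" "odd (card Q)" "p \<notin> Q"
  obtains q where "q \<in> Q" "odds (insert p (Q - {q})) = odds Q" "even (rank_in (insert p (Q - {q})) p)"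
proof -
  have "\<exists>q\<in>Q. even (rank_in Q q) \<and> (\<forall>x\<in>Q - {q}. x < p \<longleftrightarrow> x < q)"
  proof (cases "odd (rank_in Q p)")
    case True
    \<comment> \<open>The rank of \<open>p\<close> is odd, so there is a largest point below
      \<open>p\<close>, and its rank is one less.\<close>
    define L where "L = {x\<in>Q. x < p}"
    have L: "finite L" "card L = rank_in Q p" using assms(1) by (auto simp: L_def rank_in_def)
    moreover from this have "L \<noteq> {}" using True by (metis card.empty even_zero)
    ultimately have L: "finite L" "card L = rank_in Q p" "L \<noteq> {}" by auto
    have "Max L \<in> L" using L by simp
    moreover have "{x\<in>Q. x < Max L} = L - {Max L}"
    proof -
      have "x \<le> Max L" if "x \<in> L" for x using L that by simp
      then show ?thesis using \<open>Max L \<in> L\<close> unfolding L_def by force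
    qed
    ultimately have "rank_in Q (Max L) = rank_in Q p - 1"
      using L by (simp add: rank_in_def[of Q "Max L"])
    moreover have "x < p \<longleftrightarrow> x < Max L" if "x \<in> Q - {Max L}" for x
      using \<open>{x\<in>Q. x < Max L} = L - {Max L}\<close> that by (auto simp: L_def)
    moreover have "Max L \<in> Q" using \<open>Max L \<in> L\<close> by (simp add: L_def)
    moreover have "even (rank_in Q p - 1)" using True by simp
    ultimately show ?thesis by metis
  next
    case False
    define U where "U = {x\<in>Q. x > p}"
    define L where "L = {x\<in>Q. x < p}"
    have "Q = L \<union> U" using assms(3) by (auto simp: L_def U_def) (metis neq_iff)
    moreover have "L \<inter> U = {}" "finite L" "finite U"
      and finU: "finite U"
      using assms(1) by (auto simp: L_def U_def)
    ultimately have "card Q = card L + card U" by (metis card_Un_disjoint)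
    moreover have "even (card L)" using False by (simp add: L_def rank_in_def)
    \<comment> \<open>Here the oddness of \<open>card Q\<close> enters: with an even number of
      points below \<open>p\<close>, some point must lie above it. The least such point has the same
      rank as \<open>p\<close>.\<close>
    ultimately have "U \<noteq> {}" using assms(2) by auto
    have "Min U \<in> U" using \<open>U \<noteq> {}\<close> finU by simp
    have *: "x < p \<longleftrightarrow> x < Min U" if "x \<in> Q" for x
    proof
      assume "x < p" then show "x < Min U" using \<open>Min U \<in> U\<close> by (auto simp: U_def)
    next
      assume "x < Min U"
      then have "x \<notin> U" using finU by (metis Min_le not_le)
      then show "x < p" using that assms(3) by (auto simp: U_def) (metis neq_iff)
    qed
    then have "rank_in Q (Min U) = rank_in Q p"
      unfolding rank_in_def by (intro arg_cong[where f = card]) auto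
    moreover have "Min U \<in> Q" using \<open>Min U \<in> U\<close> by (simp add: U_def)
    ultimately show ?thesis using False * by (metis DiffE)
  qed
  then obtain q where q: "q \<in> Q" "even (rank_in Q q)" "\<And>x. x \<in> Q \<Longrightarrow> x \<noteq> q \<Longrightarrow> x < p \<longleftrightarrow> x < q"
    by auto
  let ?Q = "insert p (Q - {q})"
  have "{x\<in>?Q. x < p} = {x\<in>Q. x < q}" using q by auto
  then have rp: "rank_in ?Q p = rank_in Q q" by (simp add: rank_in_def)
  have rx: "rank_in ?Q x = rank_in Q x" if "x \<in> Q" "x \<noteq> q" for x
  proof -
    have xp: "p < x \<longleftrightarrow> q < x" using q(3)[OF that] that assms(3) by (metis linorder_neqE order.asym)
    show ?thesis
    proof (cases "q < x")
      case True
      have "{y\<in>?Q. y < x} = insert p ({y\<in>Q. y < x} - {q})" using True xp by auto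
      then show ?thesis using True q(1) assms
        by (simp add: rank_in_def card.insert_remove card_Suc_Diff1 del: card_Diff_insert)
    next
      case False
      have "{y\<in>?Q. y < x} = {y\<in>Q. y < x}" using False xp by auto
      then show ?thesis by (simp add: rank_in_def)
    qed
  qed
  have "odds ?Q = odds Q"
  proof (rule set_eqI)
    fix x
    show "x \<in> odds ?Q \<longleftrightarrow> x \<in> odds Q"
      using q(1,2) rp rx[of x] assms(3) by (cases "x = q"; cases "x = p") (auto simp: odds_def)
  qed
  then show ?thesis using that[of q] q rp by (auto simp: odds_def)
qed

text \<open>
  A function \<open>c\<close> stands for the points of its graph; \<open>d + 1\<close> of them span the "hyperplane"
  formed by the graph of the interpolating polynomial of degree at most \<open>d\<close>.
\<close>
definition lower_facets :: "nat \<Rightarrow> (real \<Rightarrow> real) \<Rightarrow> real set \<Rightarrow> real set set" where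
  "lower_facets d c R =
     {Q. Q \<subseteq> R \<and> card Q = Suc d \<and> (\<forall>x\<in>R. poly (interp Q c) x \<le> c x)}"

text \<open>The counterpart of general linear position for the points of the graph of
  \<open>c\<close> over \<open>R\<close>.\<close>

definition generic :: "nat \<Rightarrow> (real \<Rightarrow> real) \<Rightarrow> real set \<Rightarrow> bool" where
  "generic d c R \<longleftrightarrow> (\<forall>Q\<subseteq>R. card Q = Suc d \<longrightarrow> (\<forall>x\<in>R - Q. poly (interp Q c) x \<noteq> c x))"

text \<open>
  If \<open>Q\<close> and \<open>Q'\<close> share their odd vertices, then in the divided difference over \<open>Q\<close> of
  \<open>interp Q c - interp Q' c\<close> the odd terms vanish and the even ones are nonnegative. Hence the
  leading coefficients compare, and by symmetry they agree.
\<close>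
lemma inj_on_odds_lower_facets:
  assumes "finite R" "even d" "generic d c R"
  shows "inj_on odds (lower_facets d c R)"
proof -
  have coeff_le: "coeff (interp Q' c) d \<le> coeff (interp Q c) d
      \<and> (coeff (interp Q' c) d = coeff (interp Q c) d \<longrightarrow> Q' = Q)"
    if Q: "Q \<in> lower_facets d c R" "Q' \<in> lower_facets d c R" and eq: "odds Q = odds Q'" for Q Q'
  proof -
    have Q1: "Q \<subseteq> R" "card Q = Suc d" "Q' \<subseteq> R" "card Q' = Suc d"
      "\<And>x. x \<in> R \<Longrightarrow> poly (interp Q' c) x \<le> c x" 
      using Q by (auto simp: lower_facets_def)
    have fin: "finite Q" "finite Q'" using Q1(1,3) assms(1) finite_subset by auto
    define D where "D = interp Q c - interp Q' c"
    have degD: "degree D \<le> d"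
      unfolding D_def using fin Q1 by (intro degree_diff_le degree_interp)
    have term_nonneg: "poly D q / (\<Prod>x\<in>Q - {q}. q - x) \<ge> 0" if "q \<in> Q" for q
    proof (cases "q \<in> odds Q")
      case True
      then have "q \<in> Q'" using eq odds_subset by blast
      then have "poly D q = 0" using that fin by (simp add: D_def poly_interp)
      then show ?thesis by simp
    next
      case False
      then have "even (rank_in Q q)" using that by (simp add: odds_def)
      then have "(\<Prod>x\<in>Q - {q}. q - x) > 0"
        using sgn_prod_rank(1)[OF fin(1) _ that] Q1 assms(2) by simp
      moreover have "poly D q \<ge> 0" using that fin Q1 by (auto simp: D_def poly_interp)
      ultimately show ?thesis by simp
    qed
    have co: "coeff D d = (\<Sum>q\<in>Q. poly D q / (\<Prod>x\<in>Q - {q}. q - x))"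
      using coeff_eq_divdiff[OF fin(1) Q1(2) degD] by (simp add: divdiff_def)
    have ge: "coeff D d \<ge> 0" unfolding co by (intro sum_nonneg term_nonneg)
    \<comment> \<open>In the equality case every term of the nonnegative sum is 0, so the points
      over \<open>Q\<close> lie on the interpolant of \<open>Q'\<close>; genericity then forces them
      into \<open>Q'\<close>.\<close>
    have "Q' = Q" if "coeff D d = 0"
    proof -
      have z: "\<And>q. q \<in> Q \<Longrightarrow> poly D q / (\<Prod>x\<in>Q - {q}. q - x) = 0"
        using that term_nonneg fin(1) unfolding co by (subst (asm) sum_nonneg_eq_0_iff) auto
      have "poly D q = 0" if "q \<in> Q" for q
        using z[OF that] fin(1) by auto
      then have "poly (interp Q' c) q = c q" if "q \<in> Q" for q
        using that fin(1) by (force simp: D_def poly_interp)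
      then have "Q \<subseteq> Q'" using assms(3) Q1 unfolding generic_def by blast
      then show ?thesis using fin Q1 by (metis card_subset_eq)
    qed
    then show ?thesis using ge by (auto simp: D_def)
  qed
  show ?thesis
  proof (rule inj_onI)
    fix Q Q' assume *: "Q \<in> lower_facets d c R" "Q' \<in> lower_facets d c R" "odds Q = odds Q'"
    show "Q = Q'"
      using coeff_le[OF *] coeff_le[OF *(2,1) *(3)[symmetric]] by simp
  qed
qed

text \<open>
  A set with minimal leading coefficient works: a point below its interpolant could replace an
  even vertex, and this would lower the leading coefficient.
\<close>
lemma odds_lower_facets_surj:
  assumes "finite R" "even d" "Q0 \<subseteq> R" "card Q0 = Suc d"
  shows "\<exists>Q\<in>lower_facets d c R. odds Q = odds Q0"
proof -
  define C where "C = {Q. Q \<subseteq> R \<and> card Q = Suc d \<and> odds Q = odds Q0}"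
  have "finite C" "C \<noteq> {}" using assms by (auto simp: C_def)
  then obtain Q where Q: "Q \<in> C" and min: "\<And>Q'. Q' \<in> C \<Longrightarrow> divdiff Q c \<le> divdiff Q' c"
    using arg_min_if_finite(1)[of C "\<lambda>Q. divdiff Q c"] arg_min_least[of C _ "\<lambda>Q. divdiff Q c"]
    by blast
  have Q1: "Q \<subseteq> R" "card Q = Suc d" "odds Q = odds Q0" using Q by (auto simp: C_def)
  have fin: "finite Q" using Q1 assms(1) finite_subset by auto
  have "poly (interp Q c) p \<le> c p" if p: "p \<in> R" for p
  proof (rule ccontr)
    assume neg: "\<not> poly (interp Q c) p \<le> c p"
    then have "p \<notin> Q" using poly_interp[OF fin] by auto
    obtain q where q: "q \<in> Q" "odds (insert p (Q - {q})) = odds Q"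
        "even (rank_in (insert p (Q - {q})) p)"
      by (rule exchange[OF fin _ \<open>p \<notin> Q\<close>]) (use Q1 assms(2) in auto)
    define Q' where "Q' = insert p (Q - {q})"
    have fin': "finite Q'" and card': "card Q' = Suc d"
      using fin q(1) \<open>p \<notin> Q\<close> Q1 by (auto simp: Q'_def card_insert_if)
    have "Q' \<in> C" using q Q1 p card' by (auto simp: C_def Q'_def)
    define D where "D = interp Q' c - interp Q c"
    have degD: "degree D \<le> d"
      unfolding D_def using fin fin' Q1 card' by (intro degree_diff_le degree_interp)
    have z: "poly D x = 0" if "x \<in> Q' - {p}" for x
    proof -
      have "x \<in> Q" "x \<in> Q'" using that by (auto simp: Q'_def)
      then show ?thesis by (simp add: D_def poly_interp fin fin')
    qed
    have "p \<in> Q'" by (simp add: Q'_def)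
    \<comment> \<open>The two interpolants agree at the nodes shared by \<open>Q\<close> and
      \<open>Q'\<close>, so only the term of the new node \<open>p\<close> survives. Its denominator
      is positive because the rank of \<open>p\<close> in \<open>Q'\<close> is even.\<close>
    have "coeff D d = (\<Sum>x\<in>Q'. poly D x / (\<Prod>y\<in>Q' - {x}. x - y))"
      using coeff_eq_divdiff[OF fin' card' degD] by (simp add: divdiff_def)
    also have "\<dots> = poly D p / (\<Prod>y\<in>Q' - {p}. p - y)"
      using z by (subst sum.remove[OF fin' \<open>p \<in> Q'\<close>]) simp
    also have "\<dots> < 0"
    proof (rule divide_neg_pos)
      show "poly D p < 0" using neg \<open>p \<in> Q'\<close> fin' by (simp add: D_def poly_interp)
      show "(\<Prod>y\<in>Q' - {p}. p - y) > 0"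
        using sgn_prod_rank(1)[OF fin' _ \<open>p \<in> Q'\<close>] q(3) card' assms(2) by (simp add: Q'_def)
    qed
    finally have "divdiff Q' c < divdiff Q c"
      using coeff_interp fin fin' Q1 card' by (simp add: D_def)
    then show False using min[OF \<open>Q' \<in> C\<close>] by simp
  qed
  then show ?thesis using Q1 by (auto simp: lower_facets_def)
qed

subsection \<open>Counting the sets of odd vertices\<close>

text \<open>Models the sets of odd vertices: between two of them lies a vertex of even rank, so they
  are never neighbours in the ground set.\<close>

definition nonadjacent :: "nat \<Rightarrow> nat \<Rightarrow> nat set set" where
  "nonadjacent n t = {B. B \<subseteq> {..<n} \<and> card B = t \<and> (\<forall>x\<in>B. Suc x \<notin> B)}"

lemma finite_nonadjacent: "finite (nonadjacent n t)"
  by (rule finite_subset[of _ "Pow {..<n}"]) (auto simp: nonadjacent_def)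

text \<open>Split by whether the largest candidate \<open>Suc n\<close> belongs to the set; if it
  does, \<open>n\<close> is excluded and the rest lies below \<open>n\<close>.\<close>

lemma nonadjacent_Suc_Suc:
  "nonadjacent (Suc (Suc n)) (Suc t) =
     nonadjacent (Suc n) (Suc t) \<union> insert (Suc n) ` nonadjacent n t"
proof (intro set_eqI iffI)
  fix B assume B: "B \<in> nonadjacent (Suc (Suc n)) (Suc t)"
  then have fin: "finite B" by (auto simp: nonadjacent_def finite_subset)
  show "B \<in> nonadjacent (Suc n) (Suc t) \<union> insert (Suc n) ` nonadjacent n t"
  proof (cases "Suc n \<in> B")
    case True
    then have "n \<notin> B" using B by (auto simp: nonadjacent_def)
    then have "B - {Suc n} \<in> nonadjacent n t"
      using B True fin by (auto simp: nonadjacent_def less_Suc_eq subset_iff)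
    moreover have "B = insert (Suc n) (B - {Suc n})" using True by auto
    ultimately show ?thesis by blast
  next
    case False
    then have "B \<in> nonadjacent (Suc n) (Suc t)"
      using B by (auto simp: nonadjacent_def less_Suc_eq subset_iff)
    then show ?thesis by simp
  qed
next
  fix B assume "B \<in> nonadjacent (Suc n) (Suc t) \<union> insert (Suc n) ` nonadjacent n t"
  then show "B \<in> nonadjacent (Suc (Suc n)) (Suc t)"
  proof
    assume "B \<in> nonadjacent (Suc n) (Suc t)"
    then show ?thesis by (auto simp: nonadjacent_def)
  next
    assume "B \<in> insert (Suc n) ` nonadjacent n t"
    then obtain C where C: "B = insert (Suc n) C" "C \<in> nonadjacent n t" by auto
    then have "finite C" "Suc n \<notin> C" by (auto simp: nonadjacent_def finite_subset)
    then show ?thesis using C by (auto simp: nonadjacent_def)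
  qed
qed

lemma card_nonadjacent: "card (nonadjacent n t) = (n + 1 - t) choose t"
proof (induction n arbitrary: t rule: induct_nat_012)
  case 0
  have "nonadjacent 0 t = (if t = 0 then {{}} else {})"
    by (auto simp: nonadjacent_def)
  then show ?case by auto
next
  case 1
  have "nonadjacent 1 t = (if t = 0 then {{}} else if t = 1 then {{0}} else {})"
    by (auto simp: nonadjacent_def lessThan_Suc subset_singleton_iff)
  then show ?case by auto
next
  case (ge2 n)
  show ?case
  proof (cases t)
    case 0
    have "nonadjacent (Suc (Suc n)) 0 = {{}}"
      by (auto simp: nonadjacent_def finite_subset)
    then show ?thesis using 0 by simp
  next
    case (Suc s)
    have disj: "nonadjacent (Suc n) (Suc s) \<inter> insert (Suc n) ` nonadjacent n s = {}"
      by (auto simp: nonadjacent_def)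
    have inj: "inj_on (insert (Suc n)) (nonadjacent n s)"
    proof (rule inj_onI)
      fix B C assume "B \<in> nonadjacent n s" "C \<in> nonadjacent n s" "insert (Suc n) B = insert (Suc n) C"
      moreover from this have "Suc n \<notin> B" "Suc n \<notin> C" by (auto simp: nonadjacent_def)
      ultimately show "B = C" by (metis insert_ident)
    qed
    have "card (nonadjacent (Suc (Suc n)) t) =
        card (nonadjacent (Suc n) (Suc s)) + card (nonadjacent n s)"
      unfolding Suc nonadjacent_Suc_Suc
      by (simp add: card_Un_disjoint finite_nonadjacent disj card_image inj)
    also have "\<dots> = ((Suc n - s) choose Suc s) + ((Suc n - s) choose s)"
      using ge2 by simp
    \<comment> \<open>Pascal's rule. For \<open>s > Suc n\<close> the truncated differences are 0
      and both sides vanish.\<close>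
    also have "\<dots> = (Suc (Suc n) + 1 - t) choose t"
      using Suc by (cases "s \<le> Suc n") (simp_all add: Suc_diff_le binomial_eq_0 add.commute)
    finally show ?thesis .
  qed
qed

text \<open>An odd vertex is neither 0, whose rank is 0, nor \<open>r - 1\<close>, whose rank in
  \<open>Q\<close> would be \<open>2 * t\<close>; the shift by \<open>Suc\<close> skips these two
  ends. Odd vertices are not adjacent since consecutive numbers in \<open>Q\<close> have consecutive
  ranks.\<close>

lemma odds_initial_segment:
  assumes "1 < r"
  shows "odds ` {Q. Q \<subseteq> {..<r} \<and> card Q = Suc (2 * t)} = (`) Suc ` nonadjacent (r - 2) t"
proof (intro set_eqI iffI)
  fix B assume "B \<in> odds ` {Q. Q \<subseteq> {..<r} \<and> card Q = Suc (2 * t)}"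
  then obtain Q where Q: "Q \<subseteq> {..<r}" "card Q = Suc (2 * t)" "B = odds Q" by auto
  have fin: "finite Q" using Q(1) finite_subset by blast
  have z: "0 \<notin> B" by (simp add: Q odds_def rank_in_def)
  have top: "r - 1 \<notin> B"
  proof
    assume *: "r - 1 \<in> B"
    then have "{x\<in>Q. x < r - 1} = Q - {r - 1}" using Q(1) by fastforce
    then have "rank_in Q (r - 1) = 2 * t"
      using * fin Q odds_subset[of Q] by (auto simp: rank_in_def)
    then show False using * Q by (simp add: odds_def)
  qed
  have nonadj: "Suc x \<notin> B" if "x \<in> B" for x
  proof
    assume "Suc x \<in> B"
    have "{y\<in>Q. y < Suc x} = insert x {y\<in>Q. y < x}"
      using that Q(3) odds_subset[of Q] by auto
    then have "rank_in Q (Suc x) = Suc (rank_in Q x)"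
      using fin by (simp add: rank_in_def)
    then show False using that \<open>Suc x \<in> B\<close> Q(3) by (simp add: odds_def)
  qed
  have sub: "B \<subseteq> Suc ` {..<r - 2}"
  proof
    fix b assume b: "b \<in> B"
    then have "b < r" using Q odds_subset[of Q] by auto
    moreover have "b \<noteq> 0" "b \<noteq> r - 1" using b z top by metis+
    ultimately show "b \<in> Suc ` {..<r - 2}"
      using assms by (cases b) auto
  qed
  define C where "C = {x. Suc x \<in> B}"
  have BC: "B = Suc ` C" using sub by (auto simp: C_def)
  have "card C = t"
    using card_odds[OF fin] Q(2,3) by (simp add: BC card_image flip: Q(3))
  moreover have "C \<subseteq> {..<r - 2}" using sub by (auto simp: C_def)
  ultimately have "C \<in> nonadjacent (r - 2) t"
    using nonadj by (auto simp: nonadjacent_def C_def)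
  then show "B \<in> (`) Suc ` nonadjacent (r - 2) t" using BC by blast
next
  fix B assume "B \<in> (`) Suc ` nonadjacent (r - 2) t"
  then obtain C where C: "B = Suc ` C" "C \<subseteq> {..<r - 2}" "card C = t" "\<And>x. x \<in> C \<Longrightarrow> Suc x \<notin> C"
    by (auto simp: nonadjacent_def)
  have B: "finite B" "card B = t" "0 \<notin> B" "\<And>x. x \<in> B \<Longrightarrow> Suc x \<notin> B" "\<And>x. x \<in> B \<Longrightarrow> Suc x < r"
    using C by (auto simp: card_image finite_subset)
  \<comment> \<open>An initial 0, then each element of \<open>B\<close> followed by its successor:
    this gives odd rank exactly to the elements of \<open>B\<close>. Nonadjacency keeps the
    successors out of \<open>B\<close>.\<close>
  define Q where "Q = insert 0 (B \<union> Suc ` B)"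
  \<comment> \<open>Serves to count both \<open>Q\<close> itself and its parts below a given
    element.\<close>
  have cutoff: "card (insert 0 (B' \<union> Suc ` B'')) = Suc (card B' + card B'')"
    if "B' \<subseteq> B" "B'' \<subseteq> B" for B' B''
  proof -
    have "finite B'" "finite B''" "B' \<inter> Suc ` B'' = {}" "0 \<notin> B'"
      using that B finite_subset by auto
    then show ?thesis by (simp add: card_Un_disjoint card_image)
  qed
  have "rank_in Q 0 = 0" by (simp add: rank_in_def)
  moreover have "odd (rank_in Q b)" if "b \<in> B" for b
  proof -
    have "{x\<in>Q. x < b} = insert 0 ({x\<in>B. x < b} \<union> Suc ` {x\<in>B. x < b})"
    proof -
      have "Suc x < b \<longleftrightarrow> x < b" if "x \<in> B" for x
        using that \<open>b \<in> B\<close> B(4) by (metis Suc_lessI Suc_lessD)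
      moreover have "0 < b" using \<open>b \<in> B\<close> B(3) by (metis gr0I)
      ultimately show ?thesis by (auto simp: Q_def)
    qed
    then show ?thesis
      using cutoff[of "{x\<in>B. x < b}" "{x\<in>B. x < b}"] by (auto simp: rank_in_def)
  qed
  moreover have "even (rank_in Q (Suc b))" if "b \<in> B" for b
  proof -
    have "{x\<in>Q. x < Suc b} = insert 0 (insert b {x\<in>B. x < b} \<union> Suc ` {x\<in>B. x < b})"
      using that B(3,4) by (auto simp: Q_def less_Suc_eq)
    then have "rank_in Q (Suc b) = Suc (card (insert b {x\<in>B. x < b}) + card {x\<in>B. x < b})"
      using that cutoff[of "insert b {x\<in>B. x < b}" "{x\<in>B. x < b}"] by (auto simp: rank_in_def)
    then show ?thesis using B(1) by simp
  qed
  ultimately have "odds Q = B" using B(3) by (auto simp: odds_def Q_def)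
  moreover have "Q \<subseteq> {..<r}" using B assms by (auto simp: Q_def intro: Suc_lessD)
  moreover have "card Q = Suc (2 * t)" using cutoff[of B B] B(2) by (simp add: Q_def mult_2)
  ultimately show "B \<in> odds ` {Q. Q \<subseteq> {..<r} \<and> card Q = Suc (2 * t)}" by blast
qed

lemma odds_image:
  assumes "strict_mono_on A h" "Q \<subseteq> A"
  shows "odds (h ` Q) = h ` odds Q"
proof -
  have inj: "inj_on h A" using assms(1) strict_mono_on_imp_inj_on by blast
  have "rank_in (h ` Q) (h q) = rank_in Q q" if "q \<in> Q" for q
  proof -
    have "{x \<in> h ` Q. x < h q} = h ` {x\<in>Q. x < q}"
      using that assms by (auto simp: strict_mono_on_less subset_iff)
    then show ?thesis using inj assms(2)
      by (simp add: rank_in_def card_image inj_on_subset subset_iff)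
  qed
  then show ?thesis by (auto simp: odds_def)
qed

text \<open>Ranks depend only on the order, so the increasing enumeration of \<open>R\<close>
  reduces the count to \<open>{..<card R}\<close>.\<close>

lemma card_odds_image:
  fixes R :: "'a::linorder set"
  assumes "finite R" "1 < card R"
  shows "card (odds ` {Q. Q \<subseteq> R \<and> card Q = Suc (2 * t)}) = (card R - 1 - t) choose t"
proof -
  define h where "h = (!) (sorted_list_of_set R)"
  have mono: "strict_mono_on {..<card R} h"
    using strict_sorted_list_of_set[of R]
    by (auto simp: h_def strict_mono_on_def sorted_wrt_iff_nth_less)
  have inj: "inj_on h {..<card R}" using mono strict_mono_on_imp_inj_on by blast
  have img: "h ` {..<card R} = R"
    using assms(1) nth_image[of "card R" "sorted_list_of_set R"] by (simp add: h_def lessThan_atLeast0)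
  define F where "F = {Q. Q \<subseteq> {..<card R} \<and> card Q = Suc (2 * t)}"
  have "{Q. Q \<subseteq> R \<and> card Q = Suc (2 * t)} = (`) h ` F"
  proof -
    have sub: "Q \<in> (`) h ` F" if "Q \<subseteq> R" "card Q = Suc (2 * t)" for Q
    proof -
      have "Q \<subseteq> h ` {..<card R}" using that(1) by (simp only: img)
      then obtain Q' where Q': "Q' \<subseteq> {..<card R}" "Q = h ` Q'" by (rule subset_imageE)
      have "card Q' = card Q"
        unfolding Q'(2) using Q'(1) by (intro card_image[symmetric] inj_on_subset[OF inj])
      then have "Q' \<in> F" using Q'(1) that(2) by (simp add: F_def)
      then show ?thesis using Q'(2) by blast
    qed
    have sup: "h ` Q \<subseteq> R \<and> card (h ` Q) = Suc (2 * t)" if "Q \<in> F" for Q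
    proof
      have Q: "Q \<subseteq> {..<card R}" "card Q = Suc (2 * t)" using that by (auto simp: F_def)
      show "h ` Q \<subseteq> R" using image_mono[OF Q(1), of h] unfolding img .
      show "card (h ` Q) = Suc (2 * t)"
        using card_image[OF inj_on_subset[OF inj Q(1)]] Q(2) by simp
    qed
    show ?thesis
    proof (intro equalityI subsetI)
      fix Q assume "Q \<in> (`) h ` F"
      then obtain Q' where "Q' \<in> F" "Q = h ` Q'" by (rule imageE)
      then show "Q \<in> {Q. Q \<subseteq> R \<and> card Q = Suc (2 * t)}" using sup by simp
    qed (simp add: sub)
  qed
  moreover have "odds ` (`) h ` F = (`) h ` odds ` F"
    unfolding image_image by (intro image_cong refl odds_image[OF mono]) (simp add: F_def)
  ultimately have "odds ` {Q. Q \<subseteq> R \<and> card Q = Suc (2 * t)} = (`) h ` odds ` F"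
    by simp
  moreover have "inj_on ((`) h) (odds ` F)"
  proof (rule inj_on_subset[OF inj_on_image_Pow[OF inj]], rule image_subsetI)
    fix Q assume "Q \<in> F"
    then show "odds Q \<in> Pow {..<card R}" using odds_subset[of Q] by (auto simp: F_def)
  qed
  ultimately have "card (odds ` {Q. Q \<subseteq> R \<and> card Q = Suc (2 * t)}) = card (odds ` F)"
    by (simp add: card_image)
  also have "\<dots> = card ((`) Suc ` nonadjacent (card R - 2) t)"
    unfolding F_def by (simp add: odds_initial_segment[OF assms(2)])
  also have "\<dots> = card (nonadjacent (card R - 2) t)"
    by (intro card_image inj_on_subset[OF inj_on_image_Pow[of Suc UNIV]]) auto
  also have "\<dots> = (card R - 1 - t) choose t"
    using assms(2) by (simp add: card_nonadjacent)
  finally show ?thesis .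
qed

text \<open>On lower facets \<open>odds\<close> is injective and reaches every set of odd vertices
  that occurs at all, so it suffices to count the latter.\<close>

lemma card_lower_facets:
  assumes "finite R" "1 < card R" "generic (2 * t) c R"
  shows "card (lower_facets (2 * t) c R) = (card R - 1 - t) choose t"
proof -
  have "odds ` lower_facets (2 * t) c R = odds ` {Q. Q \<subseteq> R \<and> card Q = Suc (2 * t)}"
  proof (intro equalityI image_subsetI)
    fix Q assume "Q \<in> {Q. Q \<subseteq> R \<and> card Q = Suc (2 * t)}"
    then obtain Q' where Q': "Q' \<in> lower_facets (2 * t) c R" "odds Q' = odds Q"
      using odds_lower_facets_surj[OF assms(1), of "2 * t" Q c] by auto
    show "odds Q \<in> odds ` lower_facets (2 * t) c R"
      unfolding Q'(2)[symmetric] using Q'(1) by (rule imageI)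
  next
    fix Q assume "Q \<in> lower_facets (2 * t) c R"
    then show "odds Q \<in> odds ` {Q. Q \<subseteq> R \<and> card Q = Suc (2 * t)}"
      by (intro imageI) (simp add: lower_facets_def)
  qed
  then show ?thesis
    using card_image[OF inj_on_odds_lower_facets[OF assms(1) _ assms(3)]]
      card_odds_image[OF assms(1,2), of t] by simp
qed

subsection \<open>Facets of a given level\<close>

text \<open>Counts the subsets of \<open>{0..n}\<close> with \<open>a + b + 1\<close> elements by
  the member \<open>k\<close> that has \<open>a\<close> members below it and \<open>b\<close> above
  it. The formal proof applies Pascal's rule to the second factor instead.\<close>

lemma sum_choose_mult_choose:
  "(\<Sum>k\<le>n. (k choose a) * ((n - k) choose b)) = Suc n choose Suc (a + b)"
proof (induction n arbitrary: b)
  case 0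
  then show ?case by (cases a; cases b) auto
next
  case (Suc n)
  show ?case
  proof (cases b)
    case 0
    then show ?thesis using sum_choose_upper[of a "Suc n"] by (simp add: atLeast0AtMost)
  next
    case (Suc b')
    \<comment> \<open>The term for \<open>k = Suc n\<close> is 0 because
      \<open>b > 0\<close>.\<close>
    have "(\<Sum>k\<le>Suc n. (k choose a) * ((Suc n - k) choose b))
        = (\<Sum>k\<le>n. (k choose a) * ((Suc n - k) choose b))"
      using Suc by simp
    also have "\<dots> = (\<Sum>k\<le>n. (k choose a) * ((n - k) choose b') + (k choose a) * ((n - k) choose b))"
      by (intro sum.cong refl) (simp add: Suc Suc_diff_le distrib_left)
    also have "\<dots> = (Suc n choose Suc (a + b')) + (Suc n choose Suc (a + b))"
      by (simp only: sum.distrib Suc.IH)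
    also have "\<dots> = Suc (Suc n) choose Suc (a + b)"
      using Suc by simp
    finally show ?thesis .
  qed
qed

text \<open>The claimed facet numbers solve the linear system that double counting yields below.
  After \<open>term_eq\<close> the sum is the convolution \<open>sum_choose_mult_choose\<close>,
  shifted by \<open>t\<close>.\<close>

lemma sum_choose_facets:
  "(\<Sum>k\<le>N. ((k + t) choose t) * ((N - k + t) choose t) * ((N - k) choose s))
     = ((N + 2 * t + 1) choose (s + 2 * t + 1)) * ((s + t) choose t)"
proof -
  \<comment> \<open>Choosing \<open>t\<close> and then \<open>s\<close> of \<open>j + t\<close>
    elements amounts to choosing \<open>s + t\<close> of them and then the \<open>t\<close> among
    these.\<close>
  have term_eq: "((j + t) choose t) * (j choose s) = ((j + t) choose (s + t)) * ((s + t) choose t)" for j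
  proof (cases "s \<le> j")
    case True
    then show ?thesis using choose_mult[of t "s + t" "j + t"] by simp
  next
    case False
    then show ?thesis by (simp add: binomial_eq_0)
  qed
  have "(\<Sum>k\<le>N. ((k + t) choose t) * ((N - k + t) choose t) * ((N - k) choose s))
      = (\<Sum>k\<le>N. ((k + t) choose t) * ((N - k + t) choose (s + t))) * ((s + t) choose t)"
    by (simp only: sum_distrib_right mult.assoc term_eq)
  also have "(\<Sum>k\<le>N. ((k + t) choose t) * ((N - k + t) choose (s + t)))
      = (\<Sum>k\<in>{t..N + t}. (k choose t) * ((N + 2 * t - k) choose (s + t)))"
    by (intro sum.reindex_bij_witness[of _ "\<lambda>k. k - t" "\<lambda>k. k + t"]) (auto simp: add.commute)
  \<comment> \<open>The added terms are 0: either \<open>k < t\<close>, or \<open>k > N + t\<close>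
    and then \<open>N + 2 * t - k < s + t\<close>.\<close>
  also have "\<dots> = (\<Sum>k\<le>N + 2 * t. (k choose t) * ((N + 2 * t - k) choose (s + t)))"
    by (intro sum.mono_neutral_left) auto
  also have "\<dots> = (N + 2 * t + 1) choose (s + 2 * t + 1)"
  proof -
    have "Suc (t + (s + t)) = s + 2 * t + 1" "Suc (N + 2 * t) = N + 2 * t + 1" by auto
    then show ?thesis by (simp only: sum_choose_mult_choose)
  qed
  finally show ?thesis .
qed

text \<open>The system is triangular with unit diagonal: for \<open>s = N - k\<close> the unknowns
  beyond \<open>k\<close> have coefficient 0 and the one at \<open>k\<close> has coefficient
  1.\<close>

lemma binomial_transform_inj:
  fixes f g :: "nat \<Rightarrow> nat"
  assumes "\<And>s. s \<le> N \<Longrightarrow> (\<Sum>k\<le>N. f k * ((N - k) choose s)) = (\<Sum>k\<le>N. g k * ((N - k) choose s))"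
    and "k \<le> N"
  shows "f k = g k"
  using assms(2)
proof (induction k rule: less_induct)
  case (less k)
  let ?s = "N - k"
  have split: "(\<Sum>i\<le>N. h i * ((N - i) choose ?s)) = (\<Sum>i<k. h i * ((N - i) choose ?s)) + h k"
    for h :: "nat \<Rightarrow> nat"
  proof -
    have "(\<Sum>i\<le>N. h i * ((N - i) choose ?s)) = (\<Sum>i\<in>{..<k} \<union> {k}. h i * ((N - i) choose ?s))"
      by (rule sum.mono_neutral_right) (use less.prems in auto)
    then show ?thesis by simp
  qed
  have "(\<Sum>i<k. f i * ((N - i) choose ?s)) = (\<Sum>i<k. g i * ((N - i) choose ?s))"
    using less by (intro sum.cong) auto
  then show ?case using assms(1)[of ?s] unfolding split by simp
qed

text \<open>The name refers to the interpolant: the points of the graph of \<open>c\<close>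
  collected here lie below it.\<close>

definition above :: "(real \<Rightarrow> real) \<Rightarrow> real set \<Rightarrow> real set \<Rightarrow> real set" where
  "above c X Q = {x\<in>X. poly (interp Q c) x > c x}"

definition level_facets :: "nat \<Rightarrow> (real \<Rightarrow> real) \<Rightarrow> real set \<Rightarrow> nat \<Rightarrow> real set set" where
  "level_facets d c X k = {Q. Q \<subseteq> X \<and> card Q = Suc d \<and> card (above c X Q) = k}"

text \<open>Such an \<open>R\<close> is \<open>Q\<close> together with any \<open>s\<close> elements
  of \<open>X - Q - A\<close>.\<close>

lemma card_between:
  assumes "finite X" "Q \<subseteq> X" "A \<subseteq> X" "Q \<inter> A = {}"
  shows "card {R. R \<subseteq> X \<and> card R = card Q + s \<and> Q \<subseteq> R \<and> R \<inter> A = {}}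
    = (card X - card Q - card A) choose s"
proof -
  have fin: "finite Q" "finite A" using assms(1-3) finite_subset by auto
  have "bij_betw (\<lambda>T. Q \<union> T) {T. T \<subseteq> X - Q - A \<and> card T = s}
      {R. R \<subseteq> X \<and> card R = card Q + s \<and> Q \<subseteq> R \<and> R \<inter> A = {}}"
  proof (rule bij_betw_byWitness[where f' = "\<lambda>R. R - Q"])
    show "(\<union>) Q ` {T. T \<subseteq> X - Q - A \<and> card T = s}
        \<subseteq> {R. R \<subseteq> X \<and> card R = card Q + s \<and> Q \<subseteq> R \<and> R \<inter> A = {}}"
    proof (rule image_subsetI)
      fix T assume T: "T \<in> {T. T \<subseteq> X - Q - A \<and> card T = s}"
      then have "finite T" "Q \<inter> T = {}" using assms(1) finite_subset[of T X] by auto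
      then have "card (Q \<union> T) = card Q + s" using T fin by (simp add: card_Un_disjoint)
      then show "Q \<union> T \<in> {R. R \<subseteq> X \<and> card R = card Q + s \<and> Q \<subseteq> R \<and> R \<inter> A = {}}"
        using T assms by auto
    qed
    show "(\<lambda>R. R - Q) ` {R. R \<subseteq> X \<and> card R = card Q + s \<and> Q \<subseteq> R \<and> R \<inter> A = {}}
        \<subseteq> {T. T \<subseteq> X - Q - A \<and> card T = s}"
      using fin by (auto simp: card_Diff_subset)
  qed auto
  then have "card {R. R \<subseteq> X \<and> card R = card Q + s \<and> Q \<subseteq> R \<and> R \<inter> A = {}}
      = card {T. T \<subseteq> X - Q - A \<and> card T = s}"
    by (rule bij_betw_same_card[symmetric])
  also have "\<dots> = card (X - Q - A) choose s"
    using assms(1) by (simp add: n_subsets)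
  also have "card (X - Q - A) = card X - card Q - card A"
  proof -
    have "A \<subseteq> X - Q" using assms by auto
    then show ?thesis using fin assms by (simp add: card_Diff_subset)
  qed
  finally show ?thesis .
qed

lemma card_above_le:
  assumes "finite X" "Q \<subseteq> X"
  shows "above c X Q \<inter> Q = {}" "card (above c X Q) \<le> card X - card Q"
proof -
  have fin: "finite Q" using assms finite_subset by auto
  show disj: "above c X Q \<inter> Q = {}" using fin by (auto simp: above_def poly_interp)
  then have "above c X Q \<subseteq> X - Q" by (auto simp: above_def)
  then have "card (above c X Q) \<le> card (X - Q)" using assms by (intro card_mono) auto
  then show "card (above c X Q) \<le> card X - card Q" using fin assms by (simp add: card_Diff_subset)
qed

lemma generic_subset: "generic d c X \<Longrightarrow> R \<subseteq> X \<Longrightarrow> generic d c R"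
  unfolding generic_def by blast

text \<open>The sides are determined once, with respect to \<open>X\<close>, so that
  \<open>Q\<close> can be held fixed while \<open>R\<close> varies.\<close>

lemma lower_facets_eq_above:
  assumes "R \<subseteq> X"
  shows "lower_facets d c R = {Q. Q \<subseteq> R \<and> card Q = Suc d \<and> R \<inter> above c X Q = {}}"
  using assms unfolding lower_facets_def above_def by (auto simp: not_less)

text \<open>
  Double counting of pairs of a set \<open>R\<close> of size \<open>s + 2 * t + 1\<close> and a lower facet \<open>Q\<close> of \<open>R\<close>:
  \<open>R - Q\<close> must avoid \<open>Q\<close> and the points below the interpolant of \<open>Q\<close>.
\<close>
lemma sum_card_level_facets:
  assumes "finite X" "card X = N + 2 * t + 1" "generic (2 * t) c X" "0 < t"
  shows "(\<Sum>k\<le>N. card (level_facets (2 * t) c X k) * ((N - k) choose s))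
     = ((N + 2 * t + 1) choose (s + 2 * t + 1)) * ((s + t) choose t)"
proof -
  define QQ where "QQ = {Q. Q \<subseteq> X \<and> card Q = Suc (2 * t)}"
  define RR where "RR = {R. R \<subseteq> X \<and> card R = Suc (2 * t) + s}"
  have fin: "finite QQ" "finite RR" using assms(1) by (auto simp: QQ_def RR_def)
  have le: "card (above c X Q) \<le> N" if "Q \<in> QQ" for Q
    using card_above_le(2)[OF assms(1), of Q c] that assms(2) by (simp add: QQ_def)
  have byR: "(\<Sum>Q\<in>QQ. if Q \<subseteq> R \<and> R \<inter> above c X Q = {} then 1 else 0) = (s + t) choose t"
    if "R \<in> RR" for R
  proof -
    have R: "R \<subseteq> X" "card R = Suc (2 * t) + s" "finite R"
      using that assms(1) finite_subset by (auto simp: RR_def)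
    have "(\<Sum>Q\<in>QQ. if Q \<subseteq> R \<and> R \<inter> above c X Q = {} then 1 else 0)
        = card {Q\<in>QQ. Q \<subseteq> R \<and> R \<inter> above c X Q = {}}"
      using fin by (simp flip: sum.inter_filter)
    also have "{Q\<in>QQ. Q \<subseteq> R \<and> R \<inter> above c X Q = {}} = lower_facets (2 * t) c R"
      using R(1) by (auto simp: lower_facets_eq_above[OF R(1)] QQ_def)
    also have "card \<dots> = (s + t) choose t"
      using card_lower_facets[OF R(3) _ generic_subset[OF assms(3) R(1)]] R(2) assms(4)
      by (simp add: mult_2 add.commute)
    finally show ?thesis .
  qed
  have byQ: "(\<Sum>R\<in>RR. if Q \<subseteq> R \<and> R \<inter> above c X Q = {} then 1 else 0)
      = (N - card (above c X Q)) choose s" if "Q \<in> QQ" for Q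
  proof -
    have Q: "Q \<subseteq> X" "card Q = Suc (2 * t)" using that by (auto simp: QQ_def)
    have "(\<Sum>R\<in>RR. if Q \<subseteq> R \<and> R \<inter> above c X Q = {} then 1 else 0)
        = card {R\<in>RR. Q \<subseteq> R \<and> R \<inter> above c X Q = {}}"
      using fin by (simp flip: sum.inter_filter)
    also have "{R\<in>RR. Q \<subseteq> R \<and> R \<inter> above c X Q = {}}
        = {R. R \<subseteq> X \<and> card R = card Q + s \<and> Q \<subseteq> R \<and> R \<inter> above c X Q = {}}"
      using Q by (auto simp: RR_def)
    also have "card \<dots> = (card X - card Q - card (above c X Q)) choose s"
      using card_above_le(1)[OF assms(1) Q(1), of c]
      by (intro card_between assms Q) (auto simp: above_def)
    finally show ?thesis using assms(2) Q(2) by simp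
  qed
  have "(\<Sum>k\<le>N. card (level_facets (2 * t) c X k) * ((N - k) choose s))
      = (\<Sum>k\<le>N. \<Sum>Q | Q \<in> QQ \<and> card (above c X Q) = k. (N - card (above c X Q)) choose s)"
    by (intro sum.cong refl) (simp add: level_facets_def QQ_def conj_assoc)
  \<comment> \<open>The inner sums sort the \<open>Q\<close> by level, and by \<open>le\<close> no
    level exceeds \<open>N\<close>.\<close>
  also have "\<dots> = (\<Sum>Q\<in>QQ. (N - card (above c X Q)) choose s)"
    by (rule sum.group) (use fin le in auto)
  also have "\<dots> = (\<Sum>Q\<in>QQ. \<Sum>R\<in>RR. if Q \<subseteq> R \<and> R \<inter> above c X Q = {} then 1 else 0)"
    by (intro sum.cong refl) (simp only: byQ)
  also have "\<dots> = (\<Sum>R\<in>RR. \<Sum>Q\<in>QQ. if Q \<subseteq> R \<and> R \<inter> above c X Q = {} then 1 else 0)"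
    by (rule sum.swap)
  also have "\<dots> = (\<Sum>R\<in>RR. (s + t) choose t)"
    by (intro sum.cong refl) (simp only: byR)
  also have "\<dots> = ((N + 2 * t + 1) choose (s + 2 * t + 1)) * ((s + t) choose t)"
    using assms(1,2) by (simp add: RR_def n_subsets add.commute)
  finally show ?thesis .
qed

lemma card_level_facets:
  assumes "finite X" "Suc (2 * t) \<le> card X" "generic (2 * t) c X" "0 < t"
  shows "card (level_facets (2 * t) c X k) = ((k + t) choose t) * ((card X - k - t - 1) choose t)"
proof -
  define N where "N = card X - Suc (2 * t)"
  have N: "card X = N + 2 * t + 1" using assms(2) by (simp add: N_def)
  show ?thesis
  proof (cases "k \<le> N")
    case True
    have "card (level_facets (2 * t) c X k) = ((k + t) choose t) * ((N - k + t) choose t)"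
      by (rule binomial_transform_inj[where N = N, OF _ True])
        (simp only: sum_card_level_facets[OF assms(1) N assms(3,4)] sum_choose_facets)
    then show ?thesis using True N by (simp add: algebra_simps mult_2)
  next
    case False
    \<comment> \<open>Only \<open>N\<close> points lie outside \<open>Q\<close>, so higher levels
      are empty; on the right, \<open>card X - k - t - 1\<close> drops below
      \<open>t\<close>.\<close>
    have "card (above c X Q) \<le> N" if "Q \<subseteq> X" "card Q = Suc (2 * t)" for Q
      using card_above_le(2)[OF assms(1) that(1), of c] that N by simp
    then have "level_facets (2 * t) c X k = {}"
      using False by (auto simp: level_facets_def)
    then show ?thesis using False N assms(4) by simp
  qed
qed

subsection \<open>Hyperplanes and the Veronese map\<close>

text \<open>As \<open>a'\<close> vanishes on all directions of the hyperplane, its component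
  orthogonal to \<open>a\<close> is orthogonal to both \<open>a\<close> and \<open>a'\<close>, hence
  0.\<close>

lemma hyperplane_eqD:
  fixes a a' :: "'a::real_inner"
  assumes "a \<noteq> 0" "{x. a \<bullet> x = b} = {x. a' \<bullet> x = b'}"
  shows "\<exists>r. a' = r *\<^sub>R a \<and> b' = r * b"
proof -
  have aa: "a \<bullet> a \<noteq> 0" using assms(1) by simp
  define x0 where "x0 = (b / (a \<bullet> a)) *\<^sub>R a"
  have "a \<bullet> x0 = b" using aa by (simp add: x0_def)
  then have x0: "a' \<bullet> x0 = b'" using assms(2) by blast
  have orth: "a' \<bullet> y = 0" if "a \<bullet> y = 0" for y
  proof -
    have "a \<bullet> (x0 + y) = b" using \<open>a \<bullet> x0 = b\<close> that by (simp add: inner_add_right)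
    then have "a' \<bullet> (x0 + y) = b'" using assms(2) by blast
    then show ?thesis using x0 by (simp add: inner_add_right)
  qed
  define r where "r = (a \<bullet> a') / (a \<bullet> a)"
  define y where "y = a' - r *\<^sub>R a"
  have "a \<bullet> y = 0" using aa by (simp add: y_def r_def inner_diff_right)
  moreover have "a' \<bullet> y = 0" using orth calculation by blast
  ultimately have "y \<bullet> y = 0" by (simp add: y_def inner_diff_left)
  then have "a' = r *\<^sub>R a" by (simp add: y_def)
  moreover from this have "b' = r * b" using x0 \<open>a \<bullet> x0 = b\<close> by simp
  ultimately show ?thesis by blast
qed

text \<open>Any other normal vector of the hyperplane is a multiple of \<open>a\<close>, and the
  sign of the factor decides between the two sides.\<close>

lemma orientation_of_hyperplane:
  fixes a :: "'a::euclidean_space"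
  assumes "a \<noteq> 0"
  shows "orientation_of {x. a \<bullet> x = b} H \<longleftrightarrow> H = {x. a \<bullet> x > b} \<or> H = {x. a \<bullet> x < b}"
proof
  assume "orientation_of {x. a \<bullet> x = b} H"
  then obtain a' b' where H: "a' \<noteq> 0" "{x. a \<bullet> x = b} = {x. a' \<bullet> x = b'}" "H = {x. a' \<bullet> x > b'}"
    by (auto simp: orientation_of_def)
  obtain r where r: "a' = r *\<^sub>R a" "b' = r * b" using hyperplane_eqD[OF assms H(2)] by blast
  then have "r \<noteq> 0" using H(1) by auto
  then show "H = {x. a \<bullet> x > b} \<or> H = {x. a \<bullet> x < b}"
    using H(3) r by (cases "r > 0") (auto simp: mult_less_cancel_left)
next
  assume "H = {x. a \<bullet> x > b} \<or> H = {x. a \<bullet> x < b}"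
  then show "orientation_of {x. a \<bullet> x = b} H"
  proof
    assume "H = {x. a \<bullet> x > b}"
    then show ?thesis using assms by (auto simp: orientation_of_def)
  next
    assume "H = {x. a \<bullet> x < b}"
    then show ?thesis using assms unfolding orientation_of_def
      by (intro exI[of _ "- a"] exI[of _ "- b"]) auto
  qed
qed

lemma halfspaces_neq:
  fixes a :: "'a::real_inner"
  assumes "a \<noteq> 0"
  shows "{x. a \<bullet> x > b} \<noteq> {x. a \<bullet> x < b}"
proof
  assume eq: "{x. a \<bullet> x > b} = {x. a \<bullet> x < b}"
  have "((b + 1) / (a \<bullet> a)) *\<^sub>R a \<in> {x. a \<bullet> x > b}" using assms by simp
  moreover from this have "((b + 1) / (a \<bullet> a)) *\<^sub>R a \<in> {x. a \<bullet> x < b}" using eq by blast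
  ultimately show False by simp
qed

lemma affine_hull_eq_hyperplane:
  fixes a :: "'a::euclidean_space"
  assumes "\<not> affine_dependent T" "card T = DIM('a)" "T \<subseteq> {x. a \<bullet> x = b}" "a \<noteq> 0"
  shows "affine hull T = {x. a \<bullet> x = b}"
proof (rule affine_dim_equal)
  show "affine hull T \<subseteq> {x. a \<bullet> x = b}"
    using assms(3) by (intro hull_minimal affine_hyperplane)
  show "aff_dim (affine hull T) = aff_dim {x. a \<bullet> x = b}"
    using assms aff_dim_affine_independent[OF assms(1)] by simp
  have "T \<noteq> {}" using assms(2) by auto
  then show "affine hull T \<noteq> {}" by simp
qed (auto intro: affine_hyperplane)

lemma inner_HV:
  assumes "monomial_order m e"
  shows "(\<chi> i. b (e i)) \<bullet> HV m e (x, y) = (\<Sum>j\<le>m. b j * (x ^ j * y ^ (m - j)))"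
  using assms sum.reindex_bij_betw[of e UNIV "{..m}" "\<lambda>j. b j * (x ^ j * y ^ (m - j))"]
  by (simp add: monomial_order_def HV_def inner_vec_def)

text \<open>By the binomial theorem, the shear \<open>(x, y) -> (x, y + lam * x)\<close> acts
  linearly on the monomials of degree \<open>m\<close>.\<close>

lemma monomial_shear:
  fixes x y lam :: real
  assumes "i \<le> m"
  shows "x ^ i * (y + lam * x) ^ (m - i) =
    (\<Sum>j\<le>m. (if i \<le> j then of_nat ((m - i) choose (j - i)) * lam ^ (j - i) else 0) * (x ^ j * y ^ (m - j)))"
    (is "_ = (\<Sum>j\<le>m. ?b j * _)")
proof -
  have "x ^ i * (y + lam * x) ^ (m - i)
      = (\<Sum>k\<le>m - i. of_nat ((m - i) choose k) * lam ^ k * (x ^ (k + i) * y ^ (m - (k + i))))"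
    by (subst add.commute, subst binomial_ring)
      (simp add: sum_distrib_left power_mult_distrib power_add algebra_simps)
  also have "\<dots> = (\<Sum>j\<in>{i..m}. ?b j * (x ^ j * y ^ (m - j)))"
    by (rule sum.reindex_bij_witness[of _ "\<lambda>j. j - i" "\<lambda>k. k + i"]) (use assms in auto)
  also have "\<dots> = (\<Sum>j\<le>m. ?b j * (x ^ j * y ^ (m - j)))"
    by (rule sum.mono_neutral_left) auto
  finally show ?thesis .
qed

text \<open>The right-hand side is the homogenization of \<open>f\<close> in \<open>x\<close> and
  \<open>y + lam * x\<close>. Expanded by \<open>monomial_shear\<close> it becomes a form of degree
  \<open>m\<close> in \<open>x\<close> and \<open>y\<close>, which is a linear functional of the
  Veronese vector.\<close>

lemma HV_functional_exists:
  fixes e :: "'d::finite \<Rightarrow> nat"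
  assumes "monomial_order m e" "degree f \<le> m"
  shows "\<exists>a. \<forall>x y. y + lam * x \<noteq> 0 \<longrightarrow>
    a \<bullet> HV m e (x, y) = (y + lam * x) ^ m * poly f (x / (y + lam * x))"
proof -
  define B where "B i j = (if i \<le> j then of_nat ((m - i) choose (j - i)) * lam ^ (j - i) else 0)"
    for i j :: nat
  define b where "b j = (\<Sum>i\<le>m. coeff f i * B i j)" for j
  have "(\<chi> i. b (e i)) \<bullet> HV m e (x, y) = (y + lam * x) ^ m * poly f (x / (y + lam * x))"
    if nz: "y + lam * x \<noteq> 0" for x y
  proof -
    have "(\<chi> i. b (e i)) \<bullet> HV m e (x, y) = (\<Sum>j\<le>m. \<Sum>i\<le>m. coeff f i * (B i j * (x ^ j * y ^ (m - j))))"
      by (subst inner_HV[OF assms(1)]) (simp add: b_def sum_distrib_right mult.assoc)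
    also have "\<dots> = (\<Sum>i\<le>m. coeff f i * (\<Sum>j\<le>m. B i j * (x ^ j * y ^ (m - j))))"
      by (subst sum.swap) (simp add: sum_distrib_left)
    also have "\<dots> = (\<Sum>i\<le>m. coeff f i * (x ^ i * (y + lam * x) ^ (m - i)))"
      by (intro sum.cong refl) (simp add: monomial_shear B_def)
    also have "\<dots> = (\<Sum>i\<le>m. (y + lam * x) ^ m * (coeff f i * (x / (y + lam * x)) ^ i))"
      using nz by (intro sum.cong refl) (simp add: power_diff power_divide)
    also have "\<dots> = (y + lam * x) ^ m * poly f (x / (y + lam * x))"
    proof -
      have "poly f z = (\<Sum>i\<le>m. coeff f i * z ^ i)" for z
        unfolding poly_altdef using assms(2) by (intro sum.mono_neutral_left) (auto simp: coeff_eq_0)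
      then show ?thesis by (simp add: sum_distrib_left)
    qed
    finally show ?thesis .
  qed
  then show ?thesis by blast
qed

lemma collinear_with_originI:
  assumes "p \<noteq> 0" "q = r *\<^sub>R p"
  shows "\<exists>L. line_through_origin L \<and> p \<in> L \<and> q \<in> L"
  using assms unfolding line_through_origin_def
  by (intro exI[of _ "span {p}"]) (auto simp: span_base span_mul)

text \<open>
  After a shear no point of \<open>S\<close> is on the line at infinity, and linear functionals of the Veronese
  image become polynomials in the affine coordinate \<open>\<tau>\<close>, scaled by the positive weight \<open>w\<close>
  (an \<open>m\<close>-th power, \<open>m\<close> being even).
\<close>
lemma veronese_chart:
  fixes e :: "'d::finite \<Rightarrow> nat" and S :: "(real \<times> real) set"
  assumes "even m" "monomial_order m e" "finite S" "1 < card S"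
    and sep: "\<And>p q. p \<in> S \<Longrightarrow> q \<in> S \<Longrightarrow> p \<noteq> q \<Longrightarrow> \<not> (\<exists>L. line_through_origin L \<and> p \<in> L \<and> q \<in> L)"
  obtains \<tau> w where "inj_on \<tau> S" "\<And>p. p \<in> S \<Longrightarrow> w p > 0"
    "\<And>f. degree f \<le> m \<Longrightarrow> \<exists>a. \<forall>p\<in>S. a \<bullet> HV m e p = w p * poly f (\<tau> p)"
proof -
  \<comment> \<open>The origin would share a line through the origin with any other point of
    \<open>S\<close>.\<close>
  have nz: "p \<noteq> 0" if "p \<in> S" for p
  proof
    assume "p = 0"
    have "\<not> S \<subseteq> {p}" using card_mono[of "{p}" S] assms(4) by auto
    then obtain q where q: "q \<in> S" "q \<noteq> p" by auto
    then show False
      using sep[OF q(1) that q(2)] collinear_with_originI[of q p 0] \<open>p = 0\<close> by auto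
  qed
  have "infinite (UNIV - (\<lambda>p. - snd p / fst p) ` S)"
    using assms(3) by (intro Diff_infinite_finite) (auto simp: infinite_UNIV_char_0)
  \<comment> \<open>Avoiding these finitely many values keeps \<open>snd p + lam * fst p\<close>
    nonzero on \<open>S\<close>. A point with \<open>fst p = 0\<close> merely excludes 0, by the
    convention on division; for it the form is \<open>snd p\<close>, which is nonzero.\<close>
  then obtain lam where lam: "lam \<notin> (\<lambda>p. - snd p / fst p) ` S"
    by (metis Diff_iff finite.emptyI ex_in_conv)
  define l where "l p = snd p + lam * fst p" for p :: "real \<times> real"
  have l: "l p \<noteq> 0" if "p \<in> S" for p
  proof
    assume "l p = 0"
    show False
    proof (cases "fst p = 0")
      case True
      then show False using \<open>l p = 0\<close> nz[OF that] by (simp add: l_def prod_eq_iff)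
    next
      case False
      then have "lam = - snd p / fst p" using \<open>l p = 0\<close> by (simp add: l_def field_simps)
      then show False using lam that by blast
    qed
  qed
  define \<tau> where "\<tau> p = fst p / l p" for p
  have "inj_on \<tau> S"
  proof (rule inj_onI, rule ccontr)
    fix p q assume pq: "p \<in> S" "q \<in> S" "\<tau> p = \<tau> q" "p \<noteq> q"
    \<comment> \<open>Points with the same affine coordinate are proportional, with factor
      \<open>l q / l p\<close>.\<close>
    have "fst q = l q / l p * fst p" using pq l by (simp add: \<tau>_def field_simps)
    moreover have "snd q = l q - lam * fst q" "snd p = l p - lam * fst p" by (auto simp: l_def)
    ultimately have "q = (l q / l p) *\<^sub>R p"
      using l[OF pq(1)] by (simp add: prod_eq_iff right_diff_distrib)
    then show False using sep[OF pq(1,2,4)] collinear_with_originI[OF nz[OF pq(1)]] by blast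
  qed
  moreover have "l p ^ m > 0" if "p \<in> S" for p
    using l[OF that] assms(1) by (simp add: zero_less_power_eq)
  moreover have "\<exists>a. \<forall>p\<in>S. a \<bullet> HV m e p = l p ^ m * poly f (\<tau> p)" if deg: "degree f \<le> m" for f
  proof -
    obtain a where "\<forall>x y. y + lam * x \<noteq> 0 \<longrightarrow>
        a \<bullet> HV m e (x, y) = (y + lam * x) ^ m * poly f (x / (y + lam * x))"
      using HV_functional_exists[OF assms(2) deg, of lam] by blast
    then show ?thesis using l by (intro exI[of _ a]) (auto simp: l_def \<tau>_def)
  qed
  ultimately show ?thesis by (rule that)
qed

section \<open>Reduction of the theorem to level facets in the chart\<close>

theorem theorem3p9:
  fixes m n k :: nat
    and e :: "'d::finite \<Rightarrow> nat"
    and S :: "(real \<times> real) set"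
  assumes "0 < m" and "even m"
    and "monomial_order m e"
    and "finite S" and "card S = n"
    and "homogeneous_general_position m e S"
  shows "finite (homogeneous_k_facets m e k S) \<and>
         card (homogeneous_k_facets m e k S) =
           2 * ((k + m div 2) choose (m div 2)) * ((n - k - m div 2 - 1) choose (m div 2))"
proof -
  let ?V = "HV m e"
  define t where "t = m div 2"
  have m: "m = 2 * t" "0 < t" using assms(1,2) by (auto simp: t_def)
  have dim: "DIM(real ^ 'd) = m + 1"
    using assms(3) bij_betw_same_card[of e UNIV "{..m}"] by (simp add: monomial_order_def)
  have glp: "general_linear_position (?V ` S)"
    using assms(6) by (simp add: homogeneous_general_position_def)
  have "m + 2 \<le> card (?V ` S)"
    using glp assms(4) dim by (simp add: general_linear_position_def)
  then have n: "m + 2 \<le> n" using card_image_le[OF assms(4), of ?V] assms(5) by simp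
  obtain \<tau> w where chart: "inj_on \<tau> S" "\<And>p. p \<in> S \<Longrightarrow> w p > 0"
    "\<And>f. degree f \<le> m \<Longrightarrow> \<exists>a. \<forall>p\<in>S. a \<bullet> ?V p = w p * poly f (\<tau> p)"
  proof (rule veronese_chart[OF assms(2-4)])
    show "1 < card S" using n assms(5) by simp
    show "\<not> (\<exists>L. line_through_origin L \<and> p \<in> L \<and> q \<in> L)"
      if "p \<in> S" "q \<in> S" "p \<noteq> q" for p q
      using assms(6) that unfolding homogeneous_general_position_def by blast
  qed (rule that)
  have injV: "inj_on ?V S"
  proof (rule inj_onI)
    fix p q assume pq: "p \<in> S" "q \<in> S" "?V p = ?V q"
    have "w p * poly f (\<tau> p) = w q * poly f (\<tau> q)" if deg: "degree f \<le> m" for f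
    proof -
      obtain a where a: "\<forall>p\<in>S. a \<bullet> ?V p = w p * poly f (\<tau> p)" using chart(3)[OF deg] by blast
      show ?thesis using bspec[OF a pq(1)] bspec[OF a pq(2)] pq(3) by simp
    qed
    \<comment> \<open>The constant 1 recovers the weight and \<open>[:0, 1:]\<close> then the
      coordinate; the latter has degree at most \<open>m\<close> because
      \<open>m > 0\<close>.\<close>
    from this[of 1] this[of "[:0, 1:]"] have "\<tau> p = \<tau> q"
      using chart(2)[OF pq(1)] assms(1) by simp
    then show "p = q" using chart(1) pq by (simp add: inj_on_eq_iff)
  qed
  \<comment> \<open>With \<open>c\<close> equal to \<open>1 / w\<close> at the charted points, the
    functional of a polynomial takes the value 1 at \<open>?V p\<close> exactly when the polynomial
    meets \<open>c\<close> at \<open>\<tau> p\<close>.\<close>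
  define c where "c x = 1 / w (the_inv_into S \<tau> x)" for x
  have c: "c (\<tau> p) = 1 / w p" if "p \<in> S" for p
    using that chart(1) by (simp add: c_def the_inv_into_f_f)
  define X where "X = \<tau> ` S"
  define F where "F = {Q. Q \<subseteq> S \<and> card Q = m + 1}"
  have F: "Q \<subseteq> S" "card Q = m + 1" "finite Q" "finite (\<tau> ` Q)" "card (\<tau> ` Q) = Suc m" if "Q \<in> F" for Q
  proof -
    show "Q \<subseteq> S" "card Q = m + 1" using that by (auto simp: F_def)
    then show "finite Q" using assms(4) finite_subset by blast
    then show "finite (\<tau> ` Q)" by simp
    show "card (\<tau> ` Q) = Suc m"
      using \<open>Q \<subseteq> S\<close> \<open>card Q = m + 1\<close> chart(1) by (simp add: card_image inj_on_subset)
  qed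
  have "\<forall>Q\<in>F. \<exists>a. \<forall>p\<in>S. a \<bullet> ?V p = w p * poly (interp (\<tau> ` Q) c) (\<tau> p)"
    using chart(3) degree_interp F(4,5) by blast
  then obtain a where a: "\<And>Q p. Q \<in> F \<Longrightarrow> p \<in> S \<Longrightarrow>
      a Q \<bullet> ?V p = w p * poly (interp (\<tau> ` Q) c) (\<tau> p)"
    by metis
  have gt: "a Q \<bullet> ?V p > 1 \<longleftrightarrow> poly (interp (\<tau> ` Q) c) (\<tau> p) > c (\<tau> p)"
    and lt: "a Q \<bullet> ?V p < 1 \<longleftrightarrow> poly (interp (\<tau> ` Q) c) (\<tau> p) < c (\<tau> p)"
    if "Q \<in> F" "p \<in> S" for Q p
  proof -
    have "1 = w p * c (\<tau> p)" using chart(2)[OF that(2)] c[OF that(2)] by simp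
    then show "a Q \<bullet> ?V p > 1 \<longleftrightarrow> poly (interp (\<tau> ` Q) c) (\<tau> p) > c (\<tau> p)"
      and "a Q \<bullet> ?V p < 1 \<longleftrightarrow> poly (interp (\<tau> ` Q) c) (\<tau> p) < c (\<tau> p)"
      using a[OF that] chart(2)[OF that(2)] by (metis mult_less_cancel_left_pos)+
  qed
  have onQ: "?V ` Q \<subseteq> {x. a Q \<bullet> x = 1}" if "Q \<in> F" for Q
  proof (rule image_subsetI, rule CollectI)
    fix p assume "p \<in> Q"
    then have "p \<in> S" using F(1)[OF that] by blast
    moreover have "poly (interp (\<tau> ` Q) c) (\<tau> p) = c (\<tau> p)"
      using poly_interp[OF F(4)[OF that]] \<open>p \<in> Q\<close> by blast
    ultimately show "a Q \<bullet> ?V p = 1" using a[OF that] c chart(2)[of p] by simp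
  qed
  have nza: "a Q \<noteq> 0" if "Q \<in> F" for Q
  proof -
    have "Q \<noteq> {}" using F(2)[OF that] by auto
    then show ?thesis using onQ[OF that] by auto
  qed
  have indep: "\<not> affine_dependent (insert (?V p) (?V ` Q))" and
    card_ins: "card (insert (?V p) (?V ` Q)) = m + 2"
    if "Q \<in> F" "p \<in> S - Q" for Q p
  proof -
    have "insert p Q \<subseteq> S" using F(1)[OF that(1)] that(2) by auto
    then have "card (?V ` insert p Q) = card (insert p Q)"
      using injV by (meson card_image inj_on_subset)
    then show *: "card (insert (?V p) (?V ` Q)) = m + 2"
      using that(2) F(2,3)[OF that(1)] by simp
    have "insert (?V p) (?V ` Q) \<subseteq> ?V ` S" using \<open>insert p Q \<subseteq> S\<close> by auto
    then show "\<not> affine_dependent (insert (?V p) (?V ` Q))"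
      using glp * dim by (simp add: general_linear_position_def)
  qed
  have hull: "affine hull (?V ` Q) = {x. a Q \<bullet> x = 1}" if "Q \<in> F" for Q
  proof -
    \<comment> \<open>General linear position speaks of sets of \<open>m + 2\<close> points; since
      \<open>m + 2 \<le> n\<close>, \<open>Q\<close> extends to such a set.\<close>
    have "\<not> S \<subseteq> Q"
      using card_mono[OF F(3)[OF that], of S] F(2)[OF that] n assms(5) by auto
    then obtain p where "p \<in> S - Q" by auto
    then have "\<not> affine_dependent (?V ` Q)"
      using affine_independent_subset[OF indep[OF that]] by blast
    moreover have "card (?V ` Q) = DIM(real ^ 'd)"
      using F(1,2)[OF that] dim injV by (metis card_image inj_on_subset)
    ultimately show ?thesis
      using affine_hull_eq_hyperplane onQ[OF that] nza[OF that] by blast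
  qed
  have "generic m c X"
    unfolding generic_def
  proof (intro allI impI ballI notI)
    fix Q' x assume Q': "Q' \<subseteq> X" "card Q' = Suc m" and x: "x \<in> X - Q'"
      and eq: "poly (interp Q' c) x = c x"
    obtain Q where Q: "Q \<subseteq> S" "Q' = \<tau> ` Q" using Q'(1) by (metis X_def subset_imageE)
    then have QF: "Q \<in> F"
      using Q'(2) card_image[OF inj_on_subset[OF chart(1) Q(1)]] by (simp add: F_def)
    obtain p where p: "p \<in> S - Q" "x = \<tau> p" using x Q by (auto simp: X_def)
    let ?T = "insert (?V p) (?V ` Q)"
    have "a Q \<bullet> ?V p = 1" using gt[OF QF, of p] lt[OF QF, of p] eq p Q by auto
    then have "?T \<subseteq> {x. a Q \<bullet> x = 1}" using onQ[OF QF] by auto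
    \<comment> \<open>The \<open>m + 2\<close> independent points have affine dimension
      \<open>m + 1\<close>, too large for a hyperplane.\<close>
    then have "aff_dim ?T \<le> aff_dim {x. a Q \<bullet> x = 1}" by (rule aff_dim_subset)
    then have "aff_dim ?T \<le> int m" using nza[OF QF] dim by simp
    then show False
      using aff_dim_affine_independent[OF indep[OF QF p(1)]] card_ins[OF QF p(1)] by simp
  qed
  moreover have "generic m (\<lambda>x. - c x) X"
    using \<open>generic m c X\<close> by (simp add: generic_def interp_uminus)
  moreover have X: "finite X" "card X = n"
    using assms(4,5) chart(1) by (auto simp: X_def card_image)
  ultimately have levels: "card (level_facets m c X k) = ((k + t) choose t) * ((n - k - t - 1) choose t)"
    "card (level_facets m (\<lambda>x. - c x) X k) = ((k + t) choose t) * ((n - k - t - 1) choose t)"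
    using card_level_facets[of X t] n m by simp_all
  define Hp where "Hp Q = {x. a Q \<bullet> x > 1}" for Q
  define Hm where "Hm Q = {x. a Q \<bullet> x < 1}" for Q
  have cardV: "card (?V ` A) = card (\<tau> ` A)" if "A \<subseteq> S" for A
    using that injV chart(1) by (metis card_image inj_on_subset)
  have cp: "card (?V ` S \<inter> Hp Q) = card (above c X (\<tau> ` Q))" if "Q \<in> F" for Q
  proof -
    have "?V ` S \<inter> Hp Q = ?V ` {p\<in>S. a Q \<bullet> ?V p > 1}" by (auto simp: Hp_def)
    moreover have "\<tau> ` {p\<in>S. a Q \<bullet> ?V p > 1} = above c X (\<tau> ` Q)"
      using gt[OF that] by (auto simp: above_def X_def)
    ultimately show ?thesis using cardV[of "{p\<in>S. a Q \<bullet> ?V p > 1}"] by auto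
  qed
  \<comment> \<open>Passing to \<open>-c\<close> negates the interpolant and so exchanges the two
    sides of the hyperplane.\<close>
  have cm: "card (?V ` S \<inter> Hm Q) = card (above (\<lambda>x. - c x) X (\<tau> ` Q))" if "Q \<in> F" for Q
  proof -
    have "?V ` S \<inter> Hm Q = ?V ` {p\<in>S. a Q \<bullet> ?V p < 1}" by (auto simp: Hm_def)
    moreover have "\<tau> ` {p\<in>S. a Q \<bullet> ?V p < 1} = above (\<lambda>x. - c x) X (\<tau> ` Q)"
      using lt[OF that] by (auto simp: above_def X_def interp_uminus)
    ultimately show ?thesis using cardV[of "{p\<in>S. a Q \<bullet> ?V p < 1}"] by auto
  qed
  define Fp where "Fp = {Q\<in>F. card (above c X (\<tau> ` Q)) = k}"
  define Fm where "Fm = {Q\<in>F. card (above (\<lambda>x. - c x) X (\<tau> ` Q)) = k}"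
  have card_chart: "card {Q\<in>F. card (above c' X (\<tau> ` Q)) = k} = card (level_facets m c' X k)" for c'
  proof -
    have "level_facets m c' X k = (`) \<tau> ` {Q\<in>F. card (above c' X (\<tau> ` Q)) = k}" (is "?L = ?R")
    proof
      show "?R \<subseteq> ?L" using F by (auto simp: level_facets_def X_def)
      show "?L \<subseteq> ?R"
      proof
        fix Q' assume "Q' \<in> ?L"
        then have Q': "Q' \<subseteq> X" "card Q' = Suc m" "card (above c' X Q') = k"
          by (auto simp: level_facets_def)
        obtain Q where Q: "Q \<subseteq> S" "Q' = \<tau> ` Q" using Q'(1) by (metis X_def subset_imageE)
        then have "Q \<in> F"
          using Q'(2) card_image[OF inj_on_subset[OF chart(1) Q(1)]] by (simp add: F_def)
        then show "Q' \<in> ?R" using Q Q' by auto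
      qed
    qed
    moreover have "inj_on ((`) \<tau>) {Q\<in>F. card (above c' X (\<tau> ` Q)) = k}"
      by (rule inj_on_subset[OF inj_on_image_Pow[OF chart(1)]]) (auto simp: F_def)
    ultimately show ?thesis by (simp add: card_image)
  qed
  have "finite F" using assms(4) by (simp add: F_def)
  then have fin: "finite Fp" "finite Fm" by (auto simp: Fp_def Fm_def)
  have "homogeneous_k_facets m e k S = (\<lambda>Q. (Q, Hp Q)) ` Fp \<union> (\<lambda>Q. (Q, Hm Q)) ` Fm"
  proof -
    have "(Q, H) \<in> homogeneous_k_facets m e k S \<longleftrightarrow>
        Q \<in> Fp \<and> H = Hp Q \<or> Q \<in> Fm \<and> H = Hm Q" for Q H
    proof (cases "Q \<in> F")
      case True
      have "card (?V ` Q) = m + 1"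
        using F(1,2)[OF True] injV by (metis card_image inj_on_subset)
      then have "(Q, H) \<in> homogeneous_k_facets m e k S \<longleftrightarrow>
          (H = Hp Q \<or> H = Hm Q) \<and> card (?V ` S \<inter> H) = k"
        using F(1,2)[OF True] dim orientation_of_hyperplane[OF nza[OF True], of 1 H]
        by (auto simp: homogeneous_k_facets_def k_facets_def hull[OF True] Hp_def Hm_def)
      then show ?thesis using True cp[OF True] cm[OF True] by (auto simp: Fp_def Fm_def)
    next
      case False
      then show ?thesis by (auto simp: homogeneous_k_facets_def F_def Fp_def Fm_def)
    qed
    then show ?thesis by auto
  qed
  \<comment> \<open>The same \<open>Q\<close> may contribute with both orientations; the two pairs
    differ because opposite open halfspaces do.\<close>
  moreover have "(\<lambda>Q. (Q, Hp Q)) ` Fp \<inter> (\<lambda>Q. (Q, Hm Q)) ` Fm = {}"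
  proof -
    have "Hp Q \<noteq> Hm Q" if "Q \<in> Fp" for Q
      using halfspaces_neq[OF nza, of Q 1] that by (simp add: Fp_def Hp_def Hm_def)
    then show ?thesis by auto
  qed
  moreover have "card ((\<lambda>Q. (Q, Hp Q)) ` Fp) = card Fp" "card ((\<lambda>Q. (Q, Hm Q)) ` Fm) = card Fm"
    by (auto intro!: card_image inj_onI)
  ultimately have "finite (homogeneous_k_facets m e k S)"
    "card (homogeneous_k_facets m e k S) = card Fp + card Fm"
    using fin by (simp_all add: card_Un_disjoint)
  moreover have "card Fp = card (level_facets m c X k)" "card Fm = card (level_facets m (\<lambda>x. - c x) X k)"
    unfolding Fp_def Fm_def by (rule card_chart)+
  ultimately show ?thesis using levels by (simp add: t_def)
qed

end
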